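(* Let $f_q(n)$ be the number of partitions of $n$ into $q$ parts. Then $q!\,(q-1)!\,f_q(n)$ is a two-level quasi-polynomial of degree function $q-1$, depth function $\lfloor (q-1)/2\rfloor$, and period function one.
   Context: $\mathbb N=\{0,1,2,\dots\}$. A partition of $n$ into $q$ parts is a way to write $n$ as a sum of $q$ positive integers, where the order of the summands does not matter. A function $f:\mathbb N\to\mathbb Q$ is a quasi-polynomial of degree $d$ if $f(n)=\sum_{r=0}^d b_r(n)n^{d-r}$ with periodic $b_r:\mathbb N\to\mathbb Q$ and $b_0$ not identically zero. A numerical polynomial is $g\in\mathbb Q[x]$ with $g(q)\in\mathbb Z$ for all $q\in\mathbb Z$. Two-level quasi-polynomial: let $g$ be an eventually nonnegative numerical polynomial, $S=\{q\in\mathbb N: g(q)\ge 0\}$, $e:S\to\mathbb N\cup\{-1,\infty\}$, and $p:\mathbb N\to\mathbb Z_{>0}$ with $p(r)\mid p(r+1)$ for all $r$. A two-level quasi-polynomial of degree function $g$, depth function $e$ and period function $p$ is a sequence $\{f_q\}_{q\in S}$ of quasi-polynomials, $f_q$ of degree $g(q)$, such that, writing $f_q(n)=\sum_{r\ge0}c_r(q;n)n^{g(q)-r}$ with $c_r(q;n)$ periodic in $n$ and $c_r(q;n)=0$ for $r>g(q)$, there exist polynomials $\phi_r(q;i)$ in $q$ ($r\ge 0$, $0\le i<p(r)$) with $c_r(q;n)=\phi_r(q;\,n\bmod p(r))$ for every $n\in\mathbb N$, $q\in S$ and $r\le e(q)$. For $q\in\mathbb N\setminus S$ one defines $f_q(n)=0$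 and $e(q)=-1$. Here $g(q)=q-1$, so $S=\{q\ge1\}$; period function one means $p(r)=1$ for all $r$ (so only the coefficients of codegree $r\le e(q)$ are asserted to be independent of $n$).
   Formalization: The value at q=1, n=0 is excluded: there the number of partitions is 0 while it is 1 for all n≥1, so the q=1 sequence is not a quasi-polynomial on all of ℕ; every other value is as stated. *)

theory Defs
  imports
    Complex_Main
    "HOL-Library.Multiset"
    "HOL-Library.Extended"
    "HOL-Computational_Algebra.Polynomial"
begin

definition num_partitions :: "nat \<Rightarrow> nat \<Rightarrow> nat" where
  "num_partitions q n =
     card {M :: nat multiset. size M = q \<and> (\<forall>x \<in># M. 0 < x) \<and> sum_mset M = n}"

definition periodic :: "(nat \<Rightarrow> rat) \<Rightarrow> bool" where
  "periodic b \<longleftrightarrow> (\<exists>m>0. \<forall>n. b (n + m) = b n)"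

text \<open>
  \<open>f\<close> is a quasi-polynomial of degree \<open>d\<close>, and \<open>b r\<close> is its coefficient of codegree \<open>r\<close>,
  i.e. that of \<open>n ^ (d - r)\<close>, with \<open>b r = 0\<close> for \<open>r > d\<close>.
\<close>
definition quasi_polynomial_with :: "nat \<Rightarrow> (nat \<Rightarrow> nat \<Rightarrow> rat) \<Rightarrow> (nat \<Rightarrow> rat) \<Rightarrow> bool" where
  "quasi_polynomial_with d b f \<longleftrightarrow>
     (\<forall>r. periodic (b r)) \<and>
     (\<exists>n. b 0 n \<noteq> 0) \<and>
     (\<forall>r>d. \<forall>n. b r n = 0) \<and>
     (\<forall>n. f n = (\<Sum>r\<le>d. b r n * of_nat n ^ (d - r)))"

definition numerical_polynomial :: "rat poly \<Rightarrow> bool" where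
  "numerical_polynomial g \<longleftrightarrow> (\<forall>q::int. poly g (of_int q) \<in> \<int>)"

definition degree_support :: "rat poly \<Rightarrow> nat set" where
  "degree_support g = {q. 0 \<le> poly g (of_nat q)}"

text \<open>
  The sequence \<open>f\<close> and the depth \<open>e\<close> are total functions, extended by \<open>0\<close> and \<open>-1\<close>
  outside \<open>degree_support g\<close>. The condition \<open>Fin (- 1) \<le> e q\<close> restricts the depth
  to the natural numbers, \<open>-1\<close> and infinity. On \<open>degree_support g\<close> the value
  \<open>poly g (of_nat q)\<close> is a nonnegative integer, so the floor does not change it.
\<close>
definition two_level_quasi_polynomial ::
    "rat poly \<Rightarrow> (nat \<Rightarrow> int extended) \<Rightarrow> (nat \<Rightarrow> nat) \<Rightarrow> (nat \<Rightarrow> nat \<Rightarrow> rat) \<Rightarrow> bool" where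
  "two_level_quasi_polynomial g e p f \<longleftrightarrow>
     numerical_polynomial g \<and>
     (\<forall>\<^sub>F q in sequentially. 0 \<le> poly g (of_nat q)) \<and>
     (\<forall>q \<in> degree_support g. Fin (- 1) \<le> e q) \<and>
     (\<forall>q. q \<notin> degree_support g \<longrightarrow> e q = Fin (- 1) \<and> (\<forall>n. f q n = 0)) \<and>
     (\<forall>r. 0 < p r \<and> p r dvd p (Suc r)) \<and>
     (\<exists>(c :: nat \<Rightarrow> nat \<Rightarrow> nat \<Rightarrow> rat) (\<phi> :: nat \<Rightarrow> nat \<Rightarrow> rat poly).
        (\<forall>q \<in> degree_support g.
           quasi_polynomial_with (nat \<lfloor>poly g (of_nat q)\<rfloor>) (\<lambda>r n. c r q n) (f q)) \<and>
        (\<forall>q \<in> degree_support g. \<forall>r n. Fin (int r) \<le> e q \<longrightarrow>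
           c r q n = poly (\<phi> r (n mod p r)) (of_nat q)))"

end

theory Submission
  imports Defs
begin

text \<open>
  Write \<open>f\<^sub>q(n)\<close> for the number of partitions of \<open>n\<close> into \<open>q\<close> parts and \<open>S\<close> for the shift
  \<open>n \<mapsto> n + 1\<close> acting on sequences. Removing a part \<open>1\<close> or lowering all parts gives the recurrence
  \<open>f\<^sub>q\<^sub>+\<^sub>1(n + q + 1) - f\<^sub>q\<^sub>+\<^sub>1(n) = f\<^sub>q(n + q)\<close>. The idea is to write \<open>f\<^sub>q\<close> as a polynomial \<open>P\<^sub>q\<close> in
  \<open>n\<close>, the contribution of the pole at \<open>1\<close> of the generating function, plus a remainder, the
  contribution of the other roots of unity. Both parts are found without partial fractions.

  The polynomials are chosen one after the other such that they satisfy the same recurrence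
  \<open>P\<^sub>q\<^sub>+\<^sub>1(x + q + 1) - P\<^sub>q\<^sub>+\<^sub>1(x) = P\<^sub>q(x + q)\<close>. This leaves the constant term of \<open>P\<^sub>q\<^sub>+\<^sub>1\<close> free. It is
  fixed by the requirement that the remainder \<open>f\<^sub>q - P\<^sub>q\<close> be annihilated by \<open>\<Prod>j\<le>q. \<psi>\<^sub>j(S)\<close>, where
  \<open>\<psi>\<^sub>j = 1 + x + \<dots> + x^(j - 1)\<close> (\<open>polynomial_part_step\<close>).

  Neighbouring \<open>\<psi>\<^sub>j\<close> and \<open>\<psi>\<^sub>j\<^sub>+\<^sub>1\<close> are coprime, and all \<open>\<psi>\<^sub>j\<close> with \<open>j \<le> q\<close> divide \<open>\<psi>\<^sub>N\<close> for
  \<open>N = q!\<close>. Grouping the factors into pairs, the product divides the power of \<open>\<psi>\<^sub>N\<close> with exponent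
  \<open>\<lfloor>q / 2\<rfloor>\<close> (\<open>prod_geom_dvd\<close>). So that power of \<open>S^N - 1\<close> kills the remainder, which is
  therefore a quasi-polynomial of degree less than \<open>\<lfloor>q / 2\<rfloor>\<close> (\<open>quasi_polynomial_of_differences\<close>).
  The coefficients of \<open>f\<^sub>q\<close> of degree at least \<open>\<lfloor>q / 2\<rfloor>\<close>, that is of codegree at most
  \<open>\<lfloor>(q - 1) / 2\<rfloor>\<close>, come from \<open>P\<^sub>q\<close> alone and do not depend on \<open>n\<close>.

  Finally, comparing coefficients in the recurrence of the \<open>P\<^sub>q\<close> shows that, for fixed \<open>r\<close>, the
  coefficient of codegree \<open>r\<close> times \<open>q! (q - 1 - r)!\<close> has a difference in \<open>q\<close> that is built from the
  coefficients of smaller codegree. By induction it is a polynomial in \<open>q\<close>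
  (\<open>codegree_coeff_polynomial\<close>).
\<close>

section \<open>Partitions into a fixed number of parts\<close>

abbreviation partitions where
  "partitions q n \<equiv> {M :: nat multiset. size M = q \<and> (\<forall>x \<in># M. 0 < x) \<and> sum_mset M = n}"

lemma finite_partitions: "finite (partitions q n)"
proof (rule finite_subset)
  show "partitions q n \<subseteq> mset ` {xs. set xs \<subseteq> {..n} \<and> length xs = q}"
  proof
    fix M assume M: "M \<in> partitions q n"
    obtain xs where xs: "mset xs = M" using ex_mset by blast
    have "x \<le> n" if "x \<in># M" for x
      using M that sum_mset.remove[OF that] by auto
    then have "xs \<in> {xs. set xs \<subseteq> {..n} \<and> length xs = q}"
      using M xs by auto
    then show "M \<in> mset ` {xs. set xs \<subseteq> {..n} \<and> length xs = q}"
      using xs by blast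
  qed
  show "finite (mset ` {xs. set xs \<subseteq> {..n} \<and> length xs = q})"
    by (intro finite_imageI finite_lists_length_eq) simp
qed

lemma sum_mset_image_Suc: "sum_mset (image_mset Suc M) = sum_mset M + size M"
  by (induction M) auto

text \<open>
  A partition into \<open>q + 1\<close> parts either has a part \<open>1\<close>, which can be removed, or has only
  parts greater than \<open>1\<close>, all of which can be lowered by \<open>1\<close>.
\<close>
lemma num_partitions_recurrence:
  "num_partitions (Suc q) (n + Suc q) =
     num_partitions (Suc q) n + num_partitions q (n + q)"
proof -
  let ?raise = "image_mset Suc :: nat multiset \<Rightarrow> nat multiset"
  have split: "partitions (Suc q) (n + Suc q) =
    ?raise ` partitions (Suc q) n \<union> add_mset 1 ` partitions q (n + q)"
  proof (intro equalityI subsetI)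
    fix M assume M: "M \<in> partitions (Suc q) (n + Suc q)"
    show "M \<in> ?raise ` partitions (Suc q) n \<union> add_mset 1 ` partitions q (n + q)"
    proof (cases "1 \<in># M")
      case True
      then obtain K where K: "M = add_mset 1 K" by (blast dest: multi_member_split)
      then have "K \<in> partitions q (n + q)" using M by auto
      then show ?thesis using K by blast
    next
      case False
      let ?K = "image_mset (\<lambda>x. x - 1) M"
      have big: "1 < x" if "x \<in># M" for x
        using M False that by (cases "x = 1") fastforce+
      have "?raise ?K = image_mset (\<lambda>x. x) M"
        unfolding multiset.map_comp by (rule image_mset_cong) (use big in force)
      then have eq: "?raise ?K = M" by simp
      have "sum_mset M = sum_mset ?K + size ?K"
        using sum_mset_image_Suc[of ?K] eq by simp
      then have "?K \<in> partitions (Suc q) n" using M big by auto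
      then have "?raise ?K \<in> ?raise ` partitions (Suc q) n" by (rule imageI)
      then show ?thesis unfolding eq by (rule UnI1)
    qed
  next
    fix M assume "M \<in> ?raise ` partitions (Suc q) n \<union> add_mset 1 ` partitions q (n + q)"
    then show "M \<in> partitions (Suc q) (n + Suc q)"
      by (auto simp: sum_mset_image_Suc)
  qed
  have "inj ?raise" by (rule multiset.inj_map) simp
  then have "card (?raise ` partitions (Suc q) n) = num_partitions (Suc q) n"
    unfolding num_partitions_def by (intro card_image) (auto intro: inj_on_subset)
  moreover have "card (add_mset (1::nat) ` partitions q (n + q)) = num_partitions q (n + q)"
    unfolding num_partitions_def by (intro card_image) (auto simp: inj_on_def)
  moreover have "?raise ` partitions (Suc q) n \<inter> add_mset 1 ` partitions q (n + q) = {}"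
  proof -
    have "1 \<notin># M" if "M \<in> ?raise ` partitions (Suc q) n" for M using that by auto
    moreover have "1 \<in># M" if "M \<in> add_mset 1 ` partitions q (n + q)" for M using that by auto
    ultimately show ?thesis by blast
  qed
  ultimately show ?thesis
    unfolding num_partitions_def[of "Suc q" "n + Suc q"] split
    by (subst card_Un_disjoint) (auto intro: finite_partitions)
qed

lemma num_partitions_1: "num_partitions 1 (Suc n) = 1"
proof -
  have "partitions 1 (Suc n) = {{#Suc n#}}"
    by (auto dest!: size_1_singleton_mset[unfolded One_nat_def])
  then show ?thesis unfolding num_partitions_def by simp
qed

text \<open>
  The only value changed is the one at \<open>q = 1\<close>, \<open>n = 0\<close>, from \<open>0\<close> to \<open>1\<close>. This makes
  the first sequence constant, hence a polynomial, and leaves the recurrence intact, because for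
  \<open>q = 1\<close> the recurrence reads that sequence at positive arguments only.
\<close>
definition partition_seq :: "nat \<Rightarrow> nat \<Rightarrow> rat" where
  "partition_seq q n = (if q = 1 then 1 else of_nat (num_partitions q n))"

lemma partition_seq_recurrence:
  assumes "1 \<le> q"
  shows "partition_seq (Suc q) (n + Suc q) = partition_seq (Suc q) n + partition_seq q (n + q)"
proof -
  have "q = 1 \<Longrightarrow> num_partitions q (n + q) = 1" using num_partitions_1 by simp
  then show ?thesis
    using assms num_partitions_recurrence[of q n] by (auto simp: partition_seq_def)
qed

section \<open>Polynomials in the shift operator\<close>

text \<open>
  This is \<open>p(S) f\<close> for the shift \<open>(S f) n = f (n + 1)\<close>, that is
  \<open>(p(S) f) n = (\<Sum>i. coeff p i * f (n + i))\<close>. Folding over the coefficients makes every law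
  of the action a one-line induction on \<open>p\<close>.
\<close>
definition shift_act :: "rat poly \<Rightarrow> (nat \<Rightarrow> rat) \<Rightarrow> nat \<Rightarrow> rat" where
  "shift_act p f = fold_coeffs (\<lambda>a g n. a * f n + g (Suc n)) p (\<lambda>_. 0)"

lemma shift_act_0 [simp]: "shift_act 0 f = (\<lambda>_. 0)"
  by (simp add: shift_act_def)

lemma shift_act_pCons [simp]:
  "shift_act (pCons a p) f = (\<lambda>n. a * f n + shift_act p f (Suc n))"
  by (cases "a = 0 \<and> p = 0") (auto simp add: shift_act_def fold_coeffs_def cCons_def fun_eq_iff)

lemma shift_act_add: "shift_act (p + q) f n = shift_act p f n + shift_act q f n"
  by (induction p q arbitrary: n rule: poly_induct2) (simp_all add: algebra_simps)

lemma shift_act_smult: "shift_act (smult a p) f n = a * shift_act p f n"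
  by (induction p arbitrary: n) (simp_all add: algebra_simps)

lemma shift_act_mult: "shift_act (p * q) f = shift_act p (shift_act q f)"
  by (induction p) (auto simp: shift_act_add shift_act_smult)

lemma shift_act_add_seq:
  "shift_act p (\<lambda>n. f n + g n) n = shift_act p f n + shift_act p g n"
  by (induction p arbitrary: n) (simp_all add: algebra_simps)

lemma shift_act_const: "shift_act p (\<lambda>_. c) n = poly p 1 * c"
  by (induction p arbitrary: n) (simp_all add: algebra_simps)

lemma shift_act_shift: "shift_act p (\<lambda>n. f (n + k)) n = shift_act p f (n + k)"
  by (induction p arbitrary: n) (simp_all add: algebra_simps)

lemma shift_act_zero_seq [simp]: "shift_act p (\<lambda>_. 0) = (\<lambda>_. 0)"
  by (rule ext) (simp add: shift_act_const)

lemma shift_act_monom: "shift_act (monom a k) f n = a * f (n + k)"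
  by (induction k arbitrary: n) (simp_all add: monom_0 monom_Suc)

lemma shift_act_diff: "shift_act (monom 1 N - 1) f n = f (n + N) - f n"
proof -
  have "monom (1::rat) N - 1 = monom 1 N + [:- 1:]"
    by (simp add: poly_eq_iff one_pCons coeff_pCons split: nat.split)
  then show ?thesis by (simp only: shift_act_add shift_act_monom) simp
qed

lemma shift_act_eq_0_dvd:
  assumes "p dvd q" "shift_act p f = (\<lambda>_. 0)"
  shows "shift_act q f = (\<lambda>_. 0)"
  using assms by (auto elim!: dvdE simp: shift_act_mult mult.commute[of p])

section \<open>The cofactors of \<open>x - 1\<close> in \<open>x ^ j - 1\<close>\<close>

definition geom :: "nat \<Rightarrow> rat poly" where
  "geom j = (\<Sum>i<j. monom 1 i)"

lemma geom_mult: "[:- 1, 1:] * geom j = monom 1 j - 1"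
proof (induction j)
  case (Suc j)
  then show ?case
    by (simp add: geom_def ring_distribs monom_Suc monom_0 one_pCons flip: smult_monom)
qed (simp add: geom_def)

lemma geom_Suc: "geom (Suc j) = 1 + monom 1 1 * geom j"
  unfolding geom_def by (subst sum.lessThan_Suc_shift)
    (simp add: sum_distrib_left mult_monom monom_0 one_pCons)

lemma poly_geom_1: "poly (geom j) 1 = of_nat j"
  by (simp add: geom_def poly_sum poly_monom)

lemma geom_dvd:
  assumes "a dvd b"
  shows "geom a dvd geom b"
proof -
  obtain k where k: "b = a * k" using assms by blast
  have "monom (1::rat) a - 1 dvd monom 1 a ^ k - 1 ^ k"
    by (simp only: power_diff_sumr2 dvd_triv_left)
  then have "[:- 1, 1:] * geom a dvd [:- 1, 1:] * geom b"
    unfolding geom_mult by (simp add: k monom_power)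
  then show ?thesis by (subst (asm) dvd_mult_cancel_left) auto
qed

text \<open>
  Consecutive cofactors are coprime, with the Bezout identity
  \<open>1 = geom (j + 1) - x * geom j\<close> read off from \<open>geom_Suc\<close>.
\<close>
lemma geom_mult_geom_Suc_dvd:
  assumes "geom j dvd M" "geom (Suc j) dvd M"
  shows "geom j * geom (Suc j) dvd M"
proof -
  have "geom j * geom (Suc j) dvd M * geom (Suc j)" "geom j * geom (Suc j) dvd geom j * M"
    using assms by (simp_all add: mult_dvd_mono)
  then have "geom j * geom (Suc j) dvd M * geom (Suc j) - monom 1 1 * (geom j * M)"
    by (rule dvd_diff[OF _ dvd_mult])
  also have "\<dots> = M" by (simp add: geom_Suc algebra_simps)
  finally show ?thesis .
qed

text \<open>
  Pairing neighbours, \<open>(1, 2), (3, 4), \<dots>\<close> for even \<open>q\<close> and \<open>(2, 3), (4, 5), \<dots>\<close> for odd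
  \<open>q\<close> (where \<open>geom 1 = 1\<close>), splits the product into \<open>q div 2\<close> factors each dividing \<open>M\<close>.
  This exponent bounds the order of the poles of the generating function away from \<open>1\<close>; it is
  where the depth \<open>\<lfloor>(q - 1) / 2\<rfloor>\<close> comes from.
\<close>
lemma prod_geom_dvd:
  assumes "\<And>j. 1 \<le> j \<Longrightarrow> j \<le> q \<Longrightarrow> geom j dvd M"
  shows "(\<Prod>j=1..q. geom j) dvd M ^ (q div 2)"
  using assms
proof (induction q rule: nat_induct2)
  case 1
  then show ?case by (simp add: geom_def monom_0 flip: one_pCons)
next
  case (step q)
  have "geom (Suc q) * geom (Suc (Suc q)) dvd M"
    by (intro geom_mult_geom_Suc_dvd step.prems) auto
  moreover have "(\<Prod>j=1..q. geom j) dvd M ^ (q div 2)"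
    by (intro step.IH step.prems) auto
  ultimately have "(\<Prod>j=1..q. geom j) * (geom (Suc q) * geom (Suc (Suc q))) dvd M ^ (q div 2) * M"
    by (intro mult_dvd_mono)
  then show ?case by (simp add: ac_simps)
qed simp

section \<open>Translates and differences of polynomials\<close>

lemma pcompose_monom_shift: "pcompose (monom a j) [:c, 1:] = smult (a::rat) ([:c, 1:] ^ j)"
  by (induction j) (simp_all add: monom_0 monom_Suc pcompose_pCons)

text \<open>
  This is Taylor's formula for the coefficients of \<open>p(x + c)\<close>. Each coefficient is normalised by
  the factorial of its index, so that the binomial coefficients disappear.
\<close>
lemma coeff_pcompose_shift:
  fixes p :: "rat poly"
  assumes "\<And>j. k + m < j \<Longrightarrow> coeff p j = 0"
  shows "fact k * coeff (pcompose p [:c, 1:]) k =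
           (\<Sum>i\<le>m. fact (k + i) * coeff p (k + i) * c ^ i / fact i)"
proof -
  have low: "coeff ([:c, 1:] ^ j) k = 0" if "j < k" for j
    using that degree_linear_power[of c j] by (intro coeff_eq_0) simp
  have "p = (\<Sum>j\<le>k + m. monom (coeff p j) j)"
    using assms by (intro poly_as_sum_of_monoms'[symmetric] degree_le) blast
  then have "coeff (pcompose p [:c, 1:]) k =
      coeff (pcompose (\<Sum>j\<le>k + m. monom (coeff p j) j) [:c, 1:]) k" by simp
  also have "\<dots> = (\<Sum>j\<le>k + m. coeff p j * coeff ([:c, 1:] ^ j) k)"
    by (simp add: pcompose_sum coeff_sum pcompose_monom_shift)
  also have "\<dots> = (\<Sum>j=k..k + m. coeff p j * coeff ([:c, 1:] ^ j) k)"
    by (rule sum.mono_neutral_right) (auto simp: low)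
  also have "\<dots> = (\<Sum>i\<le>m. coeff p (k + i) * coeff ([:c, 1:] ^ (k + i)) k)"
    using sum.atLeastAtMost_shift_0[of k "k + m"] by (simp add: atMost_atLeast0 add.commute)
  also have "\<dots> = (\<Sum>i\<le>m. coeff p (k + i) * (fact (k + i) / (fact k * fact i)) * c ^ i)"
    by (intro sum.cong) (simp_all add: coeff_linear_poly_power binomial_fact)
  finally show ?thesis by (simp add: sum_distrib_left field_simps)
qed

text \<open>
  The difference of \<open>t * x ^ (n + 1)\<close> has leading term \<open>t * (n + 1) * c * x ^ n\<close>, so the top
  coefficient of \<open>Q\<close> can be removed, and induction on the degree bound does the rest.
  Degree bounds are stated through vanishing coefficients, so that the bound \<open>0\<close> means the zero
  polynomial and the induction can start there.
\<close>
lemma poly_antidifference: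
  fixes Q :: "rat poly"
  assumes "c \<noteq> 0" "\<And>k. n \<le> k \<Longrightarrow> coeff Q k = 0"
  obtains P where "\<And>k. Suc n \<le> k \<Longrightarrow> coeff P k = 0" "pcompose P [:c, 1:] - P = Q"
proof -
  have "\<exists>P. (\<forall>k\<ge>Suc n. coeff P k = 0) \<and> pcompose P [:c, 1:] - P = Q"
    using assms(2)
  proof (induction n arbitrary: Q)
    case 0
    then have "Q = 0" by (simp add: poly_eq_iff)
    then show ?case by (intro exI[of _ 0]) simp
  next
    case (Suc n)
    \<comment> \<open>Chosen so that \<open>(x + c)^(n + 1) - x^(n + 1)\<close>, scaled by \<open>t\<close>, has the top coefficient of \<open>Q\<close>.\<close>
    define t where "t = coeff Q n / (of_nat (Suc n) * c)"
    define T where "T = monom t (Suc n)"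
    define D where "D = pcompose T [:c, 1:] - T"
    have D: "D = smult t ([:c, 1:] ^ Suc n) - monom t (Suc n)"
      by (simp only: D_def T_def pcompose_monom_shift)
    have high: "coeff ([:c, 1:] ^ Suc n) k = 0" if "Suc n < k" for k
      using that degree_linear_power[of c "Suc n"] by (intro coeff_eq_0) simp
    have "coeff (Q - D) k = 0" if k: "n \<le> k" for k
    proof -
      consider "k = n" | "k = Suc n" | "Suc n < k" using k by linarith
      then show ?thesis
      proof cases
        case 1
        have "coeff D n = t * (of_nat (Suc n) * c)"
          unfolding D coeff_diff coeff_smult coeff_monom
          by (subst coeff_linear_poly_power) simp_all
        also have "\<dots> = coeff Q n" using \<open>c \<noteq> 0\<close> by (simp add: t_def del: of_nat_Suc)
        finally show ?thesis using 1 by simp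
      next
        case 2
        then show ?thesis using Suc.prems by (simp only: D coeff_diff coeff_smult coeff_monom coeff_linear_power) simp
      next
        case 3
        then show ?thesis using Suc.prems high by (simp only: D coeff_diff coeff_smult coeff_monom) simp
      qed
    qed
    from Suc.IH[OF this] obtain P where P: "\<forall>k\<ge>Suc n. coeff P k = 0" "pcompose P [:c, 1:] - P = Q - D"
      by blast
    have "pcompose (P + T) [:c, 1:] - (P + T) = Q"
      using P(2) by (simp add: pcompose_add D_def algebra_simps)
    moreover have "\<forall>k\<ge>Suc (Suc n). coeff (P + T) k = 0" using P(1) by (simp add: T_def)
    ultimately show ?case by blast
  qed
  then show ?thesis using that by blast
qed

lemma poly_shift_diff:
  fixes P :: "rat poly"
  assumes "pcompose P [:c, 1:] - P = Q"
  shows "poly P (x + c) - poly P x = poly Q x"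
  using assms by (auto simp: poly_pcompose add.commute)

text \<open>
  The converse of the fact that differences of polynomials are polynomials: an antidifference of
  \<open>Q\<close> differs from \<open>g\<close> by a constant.
\<close>
lemma polynomial_of_difference:
  fixes g :: "nat \<Rightarrow> rat"
  assumes "\<And>q. m \<le> q \<Longrightarrow> g (Suc q) - g q = poly Q (of_nat q)"
  obtains P where "\<And>q. m \<le> q \<Longrightarrow> g q = poly P (of_nat q)"
proof -
  obtain P where P: "pcompose P [:1, 1:] - P = Q"
    using poly_antidifference[of 1 "Suc (degree Q)" Q] by (auto simp: coeff_eq_0)
  have "g q = poly (P + [:g m - poly P (of_nat m):]) (of_nat q)" if "m \<le> q" for q
    using that
  proof (induction q rule: dec_induct)
    case (step q)
    then show ?case
      using assms[of q] poly_shift_diff[OF P, of "of_nat q"] by (simp add: add.commute)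
  qed simp
  then show ?thesis using that by blast
qed

lemma periodic_eq_mod:
  fixes H :: "nat \<Rightarrow> 'a"
  assumes "\<And>n. H (n + N) = H n"
  shows "H n = H (n mod N)"
proof -
  have "H (r + N * k) = H r" for r k
    by (induction k) (simp_all add: assms flip: add.assoc add: add.commute[of N])
  from this[of "n mod N" "n div N"] show ?thesis by simp
qed

text \<open>
  If \<open>(S^N - 1)^h\<close> annihilates \<open>f\<close>, then \<open>f\<close> is a polynomial of degree below \<open>h\<close> on
  each residue class modulo \<open>N\<close>. Each removed factor \<open>S^N - 1\<close> is undone by an antidifference
  with step \<open>N\<close>, taken separately on each class, up to an \<open>N\<close>-periodic constant of integration.
\<close>
lemma quasi_polynomial_of_differences:
  assumes "0 < N" "shift_act ((monom 1 N - 1) ^ h) f = (\<lambda>_. 0)"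
  obtains A :: "nat \<Rightarrow> rat poly" where
    "\<And>i k. h \<le> k \<Longrightarrow> coeff (A i) k = 0" "\<And>n. f n = poly (A (n mod N)) (of_nat n)"
proof -
  have "\<exists>A :: nat \<Rightarrow> rat poly. (\<forall>i. \<forall>k\<ge>h. coeff (A i) k = 0) \<and> (\<forall>n. f n = poly (A (n mod N)) (of_nat n))"
    using assms(2)
  proof (induction h arbitrary: f)
    case 0
    then show ?case by (intro exI[of _ "\<lambda>_. 0"]) (simp add: fun_eq_iff one_pCons)
  next
    case (Suc h)
    define g where "g = shift_act (monom 1 N - 1) f"
    have g: "g n = f (n + N) - f n" for n
      by (simp only: g_def shift_act_diff)
    have "shift_act ((monom 1 N - 1) ^ h) g = (\<lambda>_. 0)"
      using Suc.prems by (simp only: g_def power_Suc2 shift_act_mult)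
    from Suc.IH[OF this] obtain A :: "nat \<Rightarrow> rat poly" where
      A: "\<And>i k. h \<le> k \<Longrightarrow> coeff (A i) k = 0" "\<And>n. g n = poly (A (n mod N)) (of_nat n)"
      by blast
    have "\<exists>B. (\<forall>k\<ge>Suc h. coeff B k = 0) \<and> pcompose B [:of_nat N, 1:] - B = A i" for i
      using poly_antidifference[of "of_nat N" h "A i"] A(1) \<open>0 < N\<close> by (metis of_nat_eq_0_iff less_irrefl)
    then obtain B where
      B: "\<And>i k. Suc h \<le> k \<Longrightarrow> coeff (B i) k = 0" "\<And>i. pcompose (B i) [:of_nat N, 1:] - B i = A i"
      by metis
    define H where "H n = f n - poly (B (n mod N)) (of_nat n)" for n
    have "H (n + N) = H n" for n
      using poly_shift_diff[OF B(2), of "n mod N" "of_nat n"] g[of n] A(2)[of n]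
      by (simp add: H_def)
    then have "H n = H (n mod N)" for n by (rule periodic_eq_mod)
    then have "f n = poly (B (n mod N) + [:H (n mod N):]) (of_nat n)" for n
      using H_def[of n] by simp
    moreover have "coeff (B i + [:H i:]) k = 0" if "Suc h \<le> k" for i k
      using that B(1) by (simp add: coeff_pCons split: nat.split)
    ultimately show ?case by (intro exI[of _ "\<lambda>i. B i + [:H i:]"]) blast
  qed
  then show ?thesis using that by blast
qed

section \<open>Coefficients of the polynomial parts\<close>

text \<open>
  Let \<open>b r q\<close> denote the normalised coefficient in the statement. Comparing coefficients in
  \<open>P (q + 1)(x + q + 1) - P (q + 1)(x) = P q (x + q)\<close> with Taylor's formula gives
  \<open>(\<Sum>i\<le>r. b (r - i) (q + 1) * (q + 1)^i / (i + 1)!) = (\<Sum>i\<le>r. b (r - i) q * q^i / i!)\<close>.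
  The terms with \<open>i = 0\<close> are \<open>b r (q + 1)\<close> and \<open>b r q\<close>, and all others have a smaller first
  argument. By induction on \<open>r\<close> the difference of \<open>b r\<close> is therefore a polynomial in \<open>q\<close>, and
  so is \<open>b r\<close>. The relations start at \<open>q = r + 1\<close>, where \<open>b r q\<close>
  is a constant coefficient; this value is the constant of integration.
\<close>
lemma codegree_coeff_polynomial:
  fixes P :: "nat \<Rightarrow> rat poly"
  assumes deg: "\<And>q k. 1 \<le> q \<Longrightarrow> q \<le> k \<Longrightarrow> coeff (P q) k = 0"
    and step: "\<And>q. 1 \<le> q \<Longrightarrow>
      pcompose (P (Suc q)) [:of_nat (Suc q), 1:] - P (Suc q) = pcompose (P q) [:of_nat q, 1:]"
  shows "\<exists>\<beta>. \<forall>q>r. fact q * fact (q - Suc r) * coeff (P q) (q - Suc r) = poly \<beta> (of_nat q)"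
proof -
  define b where "b r q = fact q * fact (q - Suc r) * coeff (P q) (q - Suc r)" for r q
  have rel: "(\<Sum>i\<le>r. b (r - i) (Suc q) * of_nat (Suc q) ^ i / fact (Suc i)) =
    (\<Sum>i\<le>r. b (r - i) q * of_nat q ^ i / fact i)" if "r < q" for r q
  proof -
    define k where "k = q - Suc r"
    have q: "q = k + Suc r" using that by (simp add: k_def)
    define x :: rat where "x = of_nat (Suc q)"
    have fact_Suc_q: "(fact (Suc q) :: rat) = x * fact q" by (simp add: x_def)
    have "x \<noteq> 0" by (simp add: x_def del: of_nat_Suc)
    have new: "fact (k + Suc i) * coeff (P (Suc q)) (k + Suc i) = b (r - i) (Suc q) / fact (Suc q)"
      if "i \<le> r" for i
    proof -
      have "Suc q - Suc (r - i) = k + Suc i" using that q by simp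
      then show ?thesis by (simp add: b_def)
    qed
    have old: "fact (k + i) * coeff (P q) (k + i) = b (r - i) q / fact q" if "i \<le> r" for i
    proof -
      have "q - Suc (r - i) = k + i" using that q by simp
      then show ?thesis by (simp add: b_def)
    qed
    have "fact k * coeff (pcompose (P (Suc q)) [:x, 1:]) k =
        (\<Sum>i\<le>Suc r. fact (k + i) * coeff (P (Suc q)) (k + i) * x ^ i / fact i)"
      by (rule coeff_pcompose_shift) (use deg q in simp)
    also have "\<dots> = fact k * coeff (P (Suc q)) k +
        (\<Sum>i\<le>r. fact (k + Suc i) * coeff (P (Suc q)) (k + Suc i) * x ^ Suc i / fact (Suc i))"
      by (subst sum.atMost_Suc_shift) simp
    also have "(\<Sum>i\<le>r. fact (k + Suc i) * coeff (P (Suc q)) (k + Suc i) * x ^ Suc i / fact (Suc i)) =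
        (\<Sum>i\<le>r. b (r - i) (Suc q) * x ^ i / fact (Suc i)) / fact q"
      unfolding sum_divide_distrib
    proof (intro sum.cong refl)
      fix i assume "i \<in> {..r}"
      then show "fact (k + Suc i) * coeff (P (Suc q)) (k + Suc i) * x ^ Suc i / fact (Suc i) =
          b (r - i) (Suc q) * x ^ i / fact (Suc i) / fact q"
        using \<open>x \<noteq> 0\<close> by (subst new) (simp_all add: fact_Suc_q del: fact_Suc)
    qed
    finally have lhs: "fact k * coeff (pcompose (P (Suc q)) [:x, 1:] - P (Suc q)) k =
        (\<Sum>i\<le>r. b (r - i) (Suc q) * x ^ i / fact (Suc i)) / fact q"
      by (simp add: right_diff_distrib)
    have "fact k * coeff (pcompose (P q) [:of_nat q, 1:]) k =
        (\<Sum>i\<le>r. fact (k + i) * coeff (P q) (k + i) * of_nat q ^ i / fact i)"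
      by (rule coeff_pcompose_shift) (use deg q in simp)
    also have "\<dots> = (\<Sum>i\<le>r. b (r - i) q * of_nat q ^ i / fact i) / fact q"
      unfolding sum_divide_distrib by (intro sum.cong refl) (simp add: old)
    finally have rhs: "fact k * coeff (pcompose (P q) [:of_nat q, 1:]) k =
        (\<Sum>i\<le>r. b (r - i) q * of_nat q ^ i / fact i) / fact q" .
    have "1 \<le> q" using q by simp
    from lhs[unfolded x_def step[OF this] rhs] have "(\<Sum>i\<le>r. b (r - i) (Suc q) * x ^ i / fact (Suc i)) / fact q =
        (\<Sum>i\<le>r. b (r - i) q * of_nat q ^ i / fact i) / fact q"
      by (simp only: x_def)
    then show ?thesis by (simp add: x_def)
  qed
  have "\<exists>\<beta>. \<forall>q>r. b r q = poly \<beta> (of_nat q)"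
  proof (induction r rule: less_induct)
    case (less r)
    then obtain \<beta> where \<beta>: "\<And>s q. s < r \<Longrightarrow> s < q \<Longrightarrow> b s q = poly (\<beta> s) (of_nat q)"
      by metis
    define Q where "Q = (\<Sum>i=1..r. smult (1 / fact i) (\<beta> (r - i) * [:0, 1:] ^ i)
        - smult (1 / fact (Suc i)) (pcompose (\<beta> (r - i) * [:0, 1:] ^ i) [:1, 1:]))"
    have "b r (Suc q) - b r q = poly Q (of_nat q)" if "Suc r \<le> q" for q
    proof -
      \<comment> \<open>The terms of index \<open>0\<close> are the unknown values of \<open>b r\<close>.\<close>
      have head: "(\<Sum>i\<le>r. f i) = f 0 + (\<Sum>i=1..r. f i)" for f :: "nat \<Rightarrow> rat"
        by (simp add: atMost_atLeast0 sum.atLeast_Suc_atMost)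
      have "b r (Suc q) - b r q = (\<Sum>i=1..r. b (r - i) q * of_nat q ^ i / fact i)
          - (\<Sum>i=1..r. b (r - i) (Suc q) * of_nat (Suc q) ^ i / fact (Suc i))"
        using rel[of r q] that unfolding head by simp
      also have "\<dots> = (\<Sum>i=1..r. poly (\<beta> (r - i)) (of_nat q) * of_nat q ^ i / fact i)
          - (\<Sum>i=1..r. poly (\<beta> (r - i)) (of_nat (Suc q)) * of_nat (Suc q) ^ i / fact (Suc i))"
        using that by (intro arg_cong2[of _ _ _ _ minus] sum.cong refl) (simp_all add: \<beta> del: of_nat_Suc)
      also have "\<dots> = poly Q (of_nat q)"
        by (simp add: Q_def poly_sum poly_pcompose sum_subtractf del: fact_Suc)
      finally show ?thesis .
    qed
    from polynomial_of_difference[OF this] obtain B where "\<And>q. Suc r \<le> q \<Longrightarrow> b r q = poly B (of_nat q)" by blast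
    then show ?case by (auto intro!: exI[of _ B])
  qed
  then show ?thesis by (simp add: b_def)
qed

text \<open>
  The difference with step \<open>q + 1\<close> multiplies the leading coefficient by \<open>(q + 1) * q\<close>, and
  translation preserves it, so no leading coefficient in the chain vanishes.
\<close>
lemma lead_coeff_recurrence:
  fixes P :: "nat \<Rightarrow> rat poly"
  assumes deg: "\<And>q k. 1 \<le> q \<Longrightarrow> q \<le> k \<Longrightarrow> coeff (P q) k = 0"
    and step: "\<And>q. 1 \<le> q \<Longrightarrow>
      pcompose (P (Suc q)) [:of_nat (Suc q), 1:] - P (Suc q) = pcompose (P q) [:of_nat q, 1:]"
    and "coeff (P 1) 0 \<noteq> 0" "1 \<le> q"
  shows "coeff (P q) (q - 1) \<noteq> 0"
  using \<open>1 \<le> q\<close>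
proof (induction q rule: dec_induct)
  case (step q)
  define k where "k = q - 1"
  have q: "q = Suc k" using step by (simp add: k_def)
  have "fact k * coeff (pcompose (P q) [:of_nat q, 1:]) k = (\<Sum>i\<le>0. fact (k + i) * coeff (P q) (k + i) * of_nat q ^ i / fact i)"
    by (rule coeff_pcompose_shift) (use deg q in simp)
  moreover have "fact k * coeff (pcompose (P (Suc q)) [:of_nat (Suc q), 1:]) k =
      (\<Sum>i\<le>Suc 0. fact (k + i) * coeff (P (Suc q)) (k + i) * of_nat (Suc q) ^ i / fact i)"
    by (rule coeff_pcompose_shift) (use deg q in simp)
  moreover have "coeff (pcompose (P (Suc q)) [:of_nat (Suc q), 1:]) k - coeff (P (Suc q)) k =
      coeff (pcompose (P q) [:of_nat q, 1:]) k"
    using assms(2)[of q] q by (metis coeff_diff le_add1 plus_1_eq_Suc)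
  ultimately show ?case using step q by auto
qed (use assms in simp)

section \<open>Splitting off the polynomial parts\<close>

text \<open>
  Subtracting from the sequence for \<open>q + 1\<close> any antidifference \<open>P0\<close> of \<open>P(x + q)\<close> leaves a
  \<open>G\<close> for which \<open>(S^(q + 1) - 1) G\<close> is a translate of the previous remainder. Hence
  \<open>\<Prod>j\<le>q. geom j\<close> kills \<open>(S^(q + 1) - 1) G\<close>. Since \<open>x^(q + 1) - 1 = (x - 1) * geom (q + 1)\<close>,
  the product up to \<open>q + 1\<close> maps \<open>G\<close> to a sequence killed by \<open>S - 1\<close>, that is, a constant.
  The product does not vanish at \<open>1\<close>, so it acts invertibly on constants, and this constant can be
  absorbed into \<open>P0\<close>.
\<close>
lemma polynomial_part_step:
  assumes "1 \<le> q" "\<And>k. q \<le> k \<Longrightarrow> coeff P k = 0"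
    and killed: "shift_act (\<Prod>j=1..q. geom j) (\<lambda>n. partition_seq q n - poly P (of_nat n)) = (\<lambda>_. 0)"
  obtains P' where "\<And>k. Suc q \<le> k \<Longrightarrow> coeff P' k = 0"
    "pcompose P' [:of_nat (Suc q), 1:] - P' = pcompose P [:of_nat q, 1:]"
    "shift_act (\<Prod>j=1..Suc q. geom j) (\<lambda>n. partition_seq (Suc q) n - poly P' (of_nat n)) = (\<lambda>_. 0)"
proof -
  let ?N = "Suc q" and ?K = "\<Prod>j=1..Suc q. geom j"
  have "coeff (pcompose P [:of_nat q, 1:]) k = 0" if "q \<le> k" for k
  proof -
    have "degree P < q"
      using \<open>1 \<le> q\<close> assms(2) by (intro degree_lessI) auto
    moreover have "degree (pcompose P [:of_nat q, 1:]) \<le> degree P"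
      using degree_pcompose_le[of P "[:of_nat q, 1:]"] by simp
    ultimately show ?thesis using that by (intro coeff_eq_0) simp
  qed
  from poly_antidifference[OF _ this, of "of_nat ?N"] obtain P0 where
    P0: "\<And>k. Suc q \<le> k \<Longrightarrow> coeff P0 k = 0" "pcompose P0 [:of_nat ?N, 1:] - P0 = pcompose P [:of_nat q, 1:]"
    by (metis of_nat_eq_0_iff nat.distinct(1))
  define G where "G n = partition_seq ?N n - poly P0 (of_nat n)" for n
  define H where "H = shift_act ?K G"
  have diff: "shift_act (monom 1 ?N - 1) G n = partition_seq q (n + q) - poly P (of_nat (n + q))" for n
  proof -
    have "shift_act (monom 1 ?N - 1) G n = G (n + ?N) - G n"
      by (rule shift_act_diff)
    also have "\<dots> = partition_seq q (n + q) - poly P (of_nat (n + q))"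
      using partition_seq_recurrence[OF \<open>1 \<le> q\<close>, of n] poly_shift_diff[OF P0(2), of "of_nat n"]
      by (simp add: G_def poly_pcompose algebra_simps)
    finally show ?thesis .
  qed
  have "H (Suc n) = H n" for n
  proof -
    have "H (n + 1) - H n = shift_act ((monom 1 1 - 1) * ?K) G n"
      unfolding H_def shift_act_mult shift_act_diff ..
    also have "(monom 1 1 - 1) * ?K = (\<Prod>j=1..q. geom j) * ([:- 1, 1:] * geom ?N)"
      using geom_mult[of 1] by (simp add: geom_def monom_0 mult_ac flip: one_pCons)
    also have "shift_act \<dots> G n =
        shift_act (\<Prod>j=1..q. geom j) (\<lambda>n. partition_seq q (n + q) - poly P (of_nat (n + q))) n"
      unfolding shift_act_mult[of "\<Prod>j=1..q. geom j"] geom_mult diff[THEN ext] ..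
    also have "\<dots> = 0"
      using shift_act_shift[of "\<Prod>j=1..q. geom j" "\<lambda>n. partition_seq q n - poly P (of_nat n)" q n]
      by (simp only: killed)
    finally show ?thesis by simp
  qed
  then have H: "H n = H 0" for n by (induction n) simp_all
  \<comment> \<open>On constants \<open>?K\<close> acts as multiplication by its value at \<open>1\<close>, which is \<open>(q + 1)!\<close>.\<close>
  define c where "c = H 0 / poly ?K 1"
  have "poly ?K 1 \<noteq> 0" by (simp add: poly_prod poly_geom_1)
  have "shift_act ?K (\<lambda>n. partition_seq ?N n - poly (P0 + [:c:]) (of_nat n)) n = 0" for n
  proof -
    have "shift_act ?K (\<lambda>n. partition_seq ?N n - poly (P0 + [:c:]) (of_nat n)) n =
        shift_act ?K (\<lambda>n. G n + (- c)) n" by (simp add: G_def algebra_simps)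
    also have "\<dots> = H n + poly ?K 1 * (- c)"
      by (simp only: shift_act_add_seq shift_act_const H_def)
    also have "\<dots> = 0" using \<open>poly ?K 1 \<noteq> 0\<close> H[of n] by (simp add: c_def)
    finally show ?thesis .
  qed
  moreover have "pcompose (P0 + [:c:]) [:of_nat ?N, 1:] - (P0 + [:c:]) = pcompose P [:of_nat q, 1:]"
    using P0(2) by (simp add: pcompose_add)
  moreover have "coeff (P0 + [:c:]) k = 0" if "Suc q \<le> k" for k
    using that P0(1) by (simp add: coeff_pCons split: nat.split)
  ultimately show ?thesis using that by blast
qed

text \<open>
  The previous step, started from \<open>P 1 = 1\<close>, the first sequence being constantly \<open>1\<close>.
\<close>
lemma polynomial_parts:
  obtains P :: "nat \<Rightarrow> rat poly" where
    "P 1 = 1"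
    "\<And>q k. 1 \<le> q \<Longrightarrow> q \<le> k \<Longrightarrow> coeff (P q) k = 0"
    "\<And>q. 1 \<le> q \<Longrightarrow>
      pcompose (P (Suc q)) [:of_nat (Suc q), 1:] - P (Suc q) = pcompose (P q) [:of_nat q, 1:]"
    "\<And>q. 1 \<le> q \<Longrightarrow>
      shift_act (\<Prod>j=1..q. geom j) (\<lambda>n. partition_seq q n - poly (P q) (of_nat n)) = (\<lambda>_. 0)"
proof -
  define good where "good q P \<longleftrightarrow> (\<forall>k\<ge>q. coeff P k = 0) \<and> (q = 1 \<longrightarrow> P = 1) \<and>
    shift_act (\<Prod>j=1..q. geom j) (\<lambda>n. partition_seq q n - poly P (of_nat n)) = (\<lambda>_. 0)" for q P
  have "\<exists>f. \<forall>m. good (Suc m) (f m) \<and>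
     pcompose (f (Suc m)) [:of_nat (Suc (Suc m)), 1:] - f (Suc m) = pcompose (f m) [:of_nat (Suc m), 1:]"
  proof (rule dependent_nat_choice)
    show "\<exists>P. good (Suc 0) P"
      by (intro exI[of _ 1]) (auto simp: good_def partition_seq_def)
  next
    fix P m assume "good (Suc m) P"
    then have P: "\<And>k. Suc m \<le> k \<Longrightarrow> coeff P k = 0"
      "shift_act (\<Prod>j=1..Suc m. geom j) (\<lambda>n. partition_seq (Suc m) n - poly P (of_nat n)) = (\<lambda>_. 0)"
      unfolding good_def by blast+
    have "1 \<le> Suc m" by simp
    from polynomial_part_step[OF this P] obtain P' where P': "\<And>k. Suc (Suc m) \<le> k \<Longrightarrow> coeff P' k = 0"
      "pcompose P' [:of_nat (Suc (Suc m)), 1:] - P' = pcompose P [:of_nat (Suc m), 1:]"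
      "shift_act (\<Prod>j=1..Suc (Suc m). geom j)
        (\<lambda>n. partition_seq (Suc (Suc m)) n - poly P' (of_nat n)) = (\<lambda>_. 0)"
      by blast
    have "good (Suc (Suc m)) P'"
      unfolding good_def using P'(1,3) by (intro conjI allI impI) simp_all
    with P'(2) show "\<exists>P'. good (Suc (Suc m)) P' \<and>
        pcompose P' [:of_nat (Suc (Suc m)), 1:] - P' = pcompose P [:of_nat (Suc m), 1:]"
      by (intro exI conjI)
  qed
  then obtain f where chain: "\<forall>m. good (Suc m) (f m) \<and>
     pcompose (f (Suc m)) [:of_nat (Suc (Suc m)), 1:] - f (Suc m) = pcompose (f m) [:of_nat (Suc m), 1:]"
    by (elim exE)
  have f: "good (Suc m) (f m)"
    "pcompose (f (Suc m)) [:of_nat (Suc (Suc m)), 1:] - f (Suc m) = pcompose (f m) [:of_nat (Suc m), 1:]" for m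
    using spec[OF chain, of m] by (rule conjunct1, rule conjunct2)
  show ?thesis
  proof (rule that[of "\<lambda>q. f (q - 1)"])
    show "f (1 - 1) = 1" using f(1)[of 0] by (simp add: good_def)
  next
    fix q k :: nat assume "1 \<le> q" "q \<le> k"
    then show "coeff (f (q - 1)) k = 0" using f(1)[of "q - 1"] by (simp add: good_def)
  next
    fix q :: nat assume "1 \<le> q"
    then show "pcompose (f (Suc q - 1)) [:of_nat (Suc q), 1:] - f (Suc q - 1) = pcompose (f (q - 1)) [:of_nat q, 1:]"
      using f(2)[of "q - 1"] by simp
  next
    fix q :: nat assume "1 \<le> q"
    then show "shift_act (\<Prod>j=1..q. geom j) (\<lambda>n. partition_seq q n - poly (f (q - 1)) (of_nat n)) = (\<lambda>_. 0)"
      using f(1)[of "q - 1"] by (simp add: good_def)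
  qed
qed

text \<open>
  All \<open>j \<le> q\<close> divide \<open>q!\<close>, so \<open>q!\<close> serves as a common period.
\<close>
lemma remainder_quasi_polynomial:
  assumes "shift_act (\<Prod>j=1..q. geom j) f = (\<lambda>_. 0)"
  obtains A :: "nat \<Rightarrow> rat poly" where
    "\<And>i k. q div 2 \<le> k \<Longrightarrow> coeff (A i) k = 0" "\<And>n. f n = poly (A (n mod fact q)) (of_nat n)"
proof -
  have "(\<Prod>j=1..q. geom j) dvd geom (fact q) ^ (q div 2)"
    by (intro prod_geom_dvd geom_dvd dvd_fact)
  also have "\<dots> dvd ([:- 1, 1:] * geom (fact q)) ^ (q div 2)"
    by (intro dvd_power_same dvd_triv_right)
  finally have "shift_act ((monom 1 (fact q) - 1) ^ (q div 2)) f = (\<lambda>_. 0)"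
    unfolding geom_mult using assms by (rule shift_act_eq_0_dvd)
  from quasi_polynomial_of_differences[OF _ this] show ?thesis using that by auto
qed

section \<open>Partition counts as a two-level quasi-polynomial\<close>

text \<open>
  The coefficients of codegree \<open>r\<close> are polynomial in \<open>q\<close> after multiplication by
  \<open>q! * (q - 1 - r)!\<close>. Passing from \<open>(q - 1 - r)!\<close> to \<open>(q - 1)!\<close> costs a falling factorial,
  which is again a polynomial in \<open>q\<close>.
\<close>
lemma of_nat_falling_factorial:
  assumes "r < q"
  shows "(fact (q - 1) :: rat) = fact (q - Suc r) * poly (\<Prod>i<r. [:- 1 - of_nat i, 1:]) (of_nat q)"
  using assms
proof (induction r)
  case (Suc r)
  have "q - Suc r = Suc (q - Suc (Suc r))" using Suc.prems by simp
  moreover have "of_nat (q - Suc r) = (of_nat q - 1 - of_nat r :: rat)"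
    using Suc.prems by (simp add: of_nat_diff)
  ultimately have "(fact (q - Suc r) :: rat) = (of_nat q - 1 - of_nat r) * fact (q - Suc (Suc r))"
    by (metis fact_Suc)
  then show ?case using Suc by (simp add: lessThan_Suc mult.assoc) (simp add: algebra_simps)
qed simp

lemma poly_by_codegree:
  fixes p :: "rat poly"
  assumes "1 \<le> q" "\<And>k. q \<le> k \<Longrightarrow> coeff p k = 0"
  shows "poly p x = (\<Sum>r\<le>q - 1. coeff p (q - Suc r) * x ^ (q - Suc r))"
proof -
  have "p = (\<Sum>k\<le>q - 1. monom (coeff p k) k)"
    using assms by (intro poly_as_sum_of_monoms'[symmetric] degree_le) auto
  then have "poly p x = poly (\<Sum>k\<le>q - 1. monom (coeff p k) k) x" by simp
  also have "\<dots> = (\<Sum>k<q. coeff p k * x ^ k)"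
    using \<open>1 \<le> q\<close> by (simp add: poly_sum poly_monom flip: lessThan_Suc_atMost)
  also have "\<dots> = (\<Sum>r<q. coeff p (q - Suc r) * x ^ (q - Suc r))"
    by (rule sum.nat_diff_reindex[symmetric])
  finally show ?thesis using \<open>1 \<le> q\<close> by (simp flip: lessThan_Suc_atMost)
qed

lemma depth_bound:
  assumes "Fin (int r) \<le> Fin \<lfloor>(of_nat q - 1 :: rat) / 2\<rfloor>"
  shows "2 * r < q"
proof -
  have "of_int (int r) \<le> (of_nat q - 1 :: rat) / 2"
    using assms unfolding le_floor_iff[symmetric] by simp
  then have "of_nat (2 * r + 1) \<le> (of_nat q :: rat)" by simp
  then show ?thesis unfolding of_nat_le_iff by simp
qed

(* The pair q = 1, n = 0 is excluded because num_partitions 1 0 = 0 while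
   num_partitions 1 n = 1 for n > 0, which is not periodic in n. *)
theorem theorem52:
  shows "\<exists>F :: nat \<Rightarrow> nat \<Rightarrow> rat.
    two_level_quasi_polynomial [:- 1, 1:]
      (\<lambda>q. Fin \<lfloor>(of_nat q - 1 :: rat) / 2\<rfloor>) (\<lambda>_. 1) F \<and>
    (\<forall>q n. 1 \<le> q \<and> (q, n) \<noteq> (1, 0) \<longrightarrow>
       F q n = fact q * fact (q - 1) * of_nat (num_partitions q n))"
proof -
  obtain P :: "nat \<Rightarrow> rat poly" where P1: "P 1 = 1"
    and deg: "\<And>q k. 1 \<le> q \<Longrightarrow> q \<le> k \<Longrightarrow> coeff (P q) k = 0"
    and step: "\<And>q. 1 \<le> q \<Longrightarrow>
      pcompose (P (Suc q)) [:of_nat (Suc q), 1:] - P (Suc q) = pcompose (P q) [:of_nat q, 1:]"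
    and killed: "\<And>q. 1 \<le> q \<Longrightarrow>
      shift_act (\<Prod>j=1..q. geom j) (\<lambda>n. partition_seq q n - poly (P q) (of_nat n)) = (\<lambda>_. 0)"
    using polynomial_parts by blast
  have "\<exists>A :: nat \<Rightarrow> rat poly. (\<forall>i. \<forall>k\<ge>q div 2. coeff (A i) k = 0) \<and>
      (\<forall>n. partition_seq q n - poly (P q) (of_nat n) = poly (A (n mod fact q)) (of_nat n))"
    if "1 \<le> q" for q
    by (rule remainder_quasi_polynomial[OF killed[OF that]]) blast
  then obtain A :: "nat \<Rightarrow> nat \<Rightarrow> rat poly" where
    A: "\<And>q i k. 1 \<le> q \<Longrightarrow> q div 2 \<le> k \<Longrightarrow> coeff (A q i) k = 0" and
    split: "\<And>q n. 1 \<le> q \<Longrightarrow>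
      partition_seq q n - poly (P q) (of_nat n) = poly (A q (n mod fact q)) (of_nat n)"
    by metis
  obtain \<beta> where \<beta>: "\<And>r q. r < q \<Longrightarrow>
      fact q * fact (q - Suc r) * coeff (P q) (q - Suc r) = poly (\<beta> r) (of_nat q)"
    using codegree_coeff_polynomial[of P, OF deg step] by metis
  define c where "c r q n = (if r < q then fact q * fact (q - 1) *
      coeff (P q + A q (n mod fact q)) (q - Suc r) else 0)" for r q n
  define \<phi> where "\<phi> r = \<beta> r * (\<Prod>i<r. [:- 1 - of_nat i, 1:])" for r
  define F where "F q n = (if q = 0 then 0 else fact q * fact (q - 1) * partition_seq q n)" for q n
  have support: "q \<in> degree_support [:- 1, 1:] \<longleftrightarrow> 1 \<le> q" for q
    by (simp add: degree_support_def)
  \<comment> \<open>Codegree \<open>r < q / 2\<close> means degree at least \<open>q div 2\<close>, out of reach of the periodic remainder.\<close>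
  have high_part: "c r q n = fact q * fact (q - 1) * coeff (P q) (q - Suc r)" if "2 * r < q" for r q n
  proof -
    have "q div 2 \<le> q - Suc r" using that by linarith
    then show ?thesis using that A[of q "q - Suc r"] by (simp add: c_def)
  qed
  have quasi: "quasi_polynomial_with (nat \<lfloor>poly [:- 1, 1:] (of_nat q :: rat)\<rfloor>) (\<lambda>r n. c r q n) (F q)"
    if q: "1 \<le> q" for q
  proof -
    have "poly [:- 1, 1:] (of_nat q) = (of_nat (q - 1) :: rat)" using q by (simp add: of_nat_diff)
    then have degree: "nat \<lfloor>poly [:- 1, 1:] (of_nat q :: rat)\<rfloor> = q - 1"
      by (simp only: floor_of_nat nat_int)
    have "periodic (c r q)" for r
      unfolding periodic_def by (intro exI[of _ "fact q"]) (simp add: c_def)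
    moreover have "c 0 q 0 \<noteq> 0"
      using high_part[of 0 q] q lead_coeff_recurrence[of P, OF deg step _ q] P1 by simp
    moreover have "F q n = (\<Sum>r\<le>q - 1. c r q n * of_nat n ^ (q - 1 - r))" for n
    proof -
      let ?p = "P q + A q (n mod fact q)"
      have "coeff ?p k = 0" if "q \<le> k" for k using that deg A q by simp
      then have "poly ?p (of_nat n) = (\<Sum>r\<le>q - 1. coeff ?p (q - Suc r) * of_nat n ^ (q - Suc r))"
        by (rule poly_by_codegree[OF q])
      moreover have "partition_seq q n = poly ?p (of_nat n)"
        using split[OF q, of n] by (simp add: algebra_simps)
      ultimately have "F q n = fact q * fact (q - 1) *
          (\<Sum>r\<le>q - 1. coeff ?p (q - Suc r) * of_nat n ^ (q - Suc r))"
        using q by (simp add: F_def)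
      also have "\<dots> = (\<Sum>r\<le>q - 1. c r q n * of_nat n ^ (q - 1 - r))"
        unfolding sum_distrib_left using q by (intro sum.cong) (auto simp: c_def mult.assoc)
      finally show ?thesis .
    qed
    moreover have "c r q n = 0" if "q - 1 < r" for r n using that q by (simp add: c_def)
    ultimately show ?thesis unfolding quasi_polynomial_with_def degree by blast
  qed
  have coefficients: "c r q n = poly (\<phi> r) (of_nat q)"
    if "Fin (int r) \<le> Fin \<lfloor>(of_nat q - 1 :: rat) / 2\<rfloor>" for r q n
  proof -
    have r: "2 * r < q" using that by (rule depth_bound)
    then have "r < q" by simp
    show ?thesis
      unfolding high_part[OF r] of_nat_falling_factorial[OF \<open>r < q\<close>] \<phi>_def poly_mult \<beta>[OF \<open>r < q\<close>, symmetric]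
      by (simp only: mult_ac)
  qed
  have "two_level_quasi_polynomial [:- 1, 1:] (\<lambda>q. Fin \<lfloor>(of_nat q - 1 :: rat) / 2\<rfloor>) (\<lambda>_. 1) F"
    unfolding two_level_quasi_polynomial_def
  proof (intro conjI)
    show "numerical_polynomial [:- 1, 1:]" by (simp add: numerical_polynomial_def)
    show "\<forall>\<^sub>F q in sequentially. (0::rat) \<le> poly [:- 1, 1:] (of_nat q)"
      using eventually_ge_at_top[of 1] by eventually_elim simp
    show "\<forall>q\<in>degree_support [:- 1, 1:]. Fin (- 1) \<le> Fin \<lfloor>(of_nat q - 1 :: rat) / 2\<rfloor>"
      by (auto simp: support le_floor_iff)
    show "\<forall>q. q \<notin> degree_support [:- 1, 1:] \<longrightarrow>
        Fin \<lfloor>(of_nat q - 1 :: rat) / 2\<rfloor> = Fin (- 1) \<and> (\<forall>n. F q n = 0)"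
      by (auto simp: support F_def floor_eq_iff not_le)
    show "\<exists>c \<phi>. (\<forall>q\<in>degree_support [:- 1, 1:].
          quasi_polynomial_with (nat \<lfloor>poly [:- 1, 1:] (of_nat q :: rat)\<rfloor>) (\<lambda>r n. c r q n) (F q)) \<and>
        (\<forall>q\<in>degree_support [:- 1, 1:]. \<forall>r n.
          Fin (int r) \<le> Fin \<lfloor>(of_nat q - 1 :: rat) / 2\<rfloor> \<longrightarrow>
          c r q n = poly (\<phi> r (n mod 1)) (of_nat q))"
      by (intro exI[of _ c] exI[of _ "\<lambda>r _. \<phi> r"] conjI ballI allI impI)
        (erule quasi[OF support[THEN iffD1]], erule coefficients)
  qed simp
  moreover have "F q n = fact q * fact (q - 1) * of_nat (num_partitions q n)"
    if qn: "1 \<le> q \<and> (q, n) \<noteq> (1, 0)" for q n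
  proof (cases "q = 1")
    case True
    then obtain m where "n = Suc m" using qn by (cases n) auto
    then show ?thesis using True num_partitions_1[of m] by (simp add: F_def partition_seq_def)
  next
    case False
    then show ?thesis using qn by (simp add: F_def partition_seq_def)
  qed
  ultimately show ?thesis by blast
qed

end
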